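(* Let $0<\varepsilon<1/6$ and $0<\lambda<1/2$, and put $I_{-1}=[0,1/3-\varepsilon]$, $I_0=[1/3+\varepsilon,2/3-\varepsilon]$, $I_1=[2/3+\varepsilon,1]$. Let $(f,g)\in\mathcal{A}$ satisfy: (i) $f(I_{-1})\subset I_{-1}$, $f(I_0)\subset\mathrm{int}(I_{-1})$, $f(I_1)\subset\mathrm{int}(I_0)$; (ii) $g(I_1)\subset I_1$, $g(I_0)\subset\mathrm{int}(I_1)$, $g(I_{-1})\subset\mathrm{int}(I_0)$; (iii) $f'(x)<\lambda$ and $g'(x)<\lambda$ for all $x\in I_{-1}\cup I_0\cup I_1$. Then the (unique) minimal set $K$ of $\langle f,g\rangle_{+}$ is homeomorphic to the Cantor set.
   Context: Let $I=[0,1]$ and let $\mathrm{Diff}^1_{\mathrm{im}}(I)$ be the set of $C^1$ maps $I\to I$ that are $C^1$-diffeomorphisms onto their images. The set $\mathcal{A}\subset(\mathrm{Diff}^1_{\mathrm{im}}(I))^2$ consists of the pairs $(f,g)$ with: $f(0)=0$ and $g(1)=1$; $f(x)<x<g(x)$ for all $x\in(0,1)$; $0<g(0)<f(1)<1$. $\langle f,g\rangle_{+}$ is the semigroup generated by $f$ and $g$ under composition. For $x\in I$, $\mathcal{O}_{+}(x)=\{\phi(x)\mid\phi\in\langle f,g\rangle_{+}\}$. A non-empty set $K\subset I$ is a minimal set if $\overline{\mathcal{O}_{+}(x)}=K$ for every $x\in K$. It is known that for $(f,g)\in\mathcal{A}$ there is a unique minimal set $K$, and $K=\overline{\mathcal{O}_{+}(0)}=\overline{\mathcal{O}_{+}(1)}$.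 $\mathrm{int}(X)$ denotes the interior of $X$. *)

theory Defs
  imports "HOL-Analysis.Analysis"
begin

text \<open>Derivatives are taken within the domain \<open>S\<close> (one-sided at end points), so that only the
  values on \<open>S\<close> matter; the library's \<open>C1_differentiable_on\<close> uses two-sided derivatives.\<close>

definition C1_within :: "(real \<Rightarrow> real) \<Rightarrow> real set \<Rightarrow> bool" where
  "C1_within f S \<longleftrightarrow>
     (\<exists>D. (\<forall>x\<in>S. (f has_real_derivative D x) (at x within S)) \<and> continuous_on S D)"

definition Diff1_im :: "(real \<Rightarrow> real) set" where
  "Diff1_im = {f. f ` {0..1} \<subseteq> {0..1} \<and> C1_within f {0..1} \<and> inj_on f {0..1} \<and>
                  C1_within (the_inv_into {0..1} f) (f ` {0..1})}"

definition class_A :: "((real \<Rightarrow> real) \<times> (real \<Rightarrow> real)) set" where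
  "class_A = {(f, g). f \<in> Diff1_im \<and> g \<in> Diff1_im \<and> f 0 = 0 \<and> g 1 = 1 \<and>
                      (\<forall>x\<in>{0<..<1}. f x < x \<and> x < g x) \<and>
                      0 < g 0 \<and> g 0 < f 1 \<and> f 1 < 1}"

text \<open>The identity is not adjoined: the elements are the nonempty words in \<open>f\<close> and \<open>g\<close>.\<close>

inductive_set semigroup_gen :: "('a \<Rightarrow> 'a) \<Rightarrow> ('a \<Rightarrow> 'a) \<Rightarrow> ('a \<Rightarrow> 'a) set"
  for f g where
  fst_gen: "f \<in> semigroup_gen f g"
| snd_gen: "g \<in> semigroup_gen f g"
| comp: "\<phi> \<in> semigroup_gen f g \<Longrightarrow> \<psi> \<in> semigroup_gen f g \<Longrightarrow> \<phi> \<circ> \<psi> \<in> semigroup_gen f g"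

definition forward_orbit :: "('a \<Rightarrow> 'a) \<Rightarrow> ('a \<Rightarrow> 'a) \<Rightarrow> 'a \<Rightarrow> 'a set" where
  "forward_orbit f g x = {\<phi> x | \<phi>. \<phi> \<in> semigroup_gen f g}"

definition minimal_set :: "(real \<Rightarrow> real) \<Rightarrow> (real \<Rightarrow> real) \<Rightarrow> real set \<Rightarrow> bool" where
  "minimal_set f g K \<longleftrightarrow>
     K \<noteq> {} \<and> K \<subseteq> {0..1} \<and> (\<forall>x\<in>K. closure (forward_orbit f g x) = K)"

text \<open>The middle-thirds Cantor set.\<close>

fun cantor_stage :: "nat \<Rightarrow> real set" where
  "cantor_stage 0 = {0..1}"
| "cantor_stage (Suc n) =
     (\<lambda>x. x / 3) ` cantor_stage n \<union> (\<lambda>x. 2 / 3 + x / 3) ` cantor_stage n"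

definition cantor_set :: "real set" where
  "cantor_set = (\<Inter>n. cantor_stage n)"

end

theory Submission
  imports Defs
begin

text \<open>
  Write \<open>K\<close> for the closure of the forward orbit of \<open>0\<close>.  A forward orbit closure is a compact set
  mapped into itself by \<open>f\<close>; its least element \<open>m\<close> satisfies \<open>m \<le> f m\<close>, and since \<open>f\<close> moves every
  other point to the left, \<open>m = 0\<close>.  So every orbit closure contains \<open>0\<close> and hence all of \<open>K\<close>, which
  makes \<open>K\<close> the only minimal set.

  The topology of \<open>K\<close> is settled by Brouwer's characterisation of the Cantor set, which on the line
  asks for a nonempty compact set without isolated points and without interior points.

  \<^item> There are no interior points because \<open>K\<close> is Lebesgue null.  It satisfies \<open>K = f ` K \<union> g ` K\<close>,
    because \<open>0 = f 0\<close>.  It lies in the union of the three given intervals, since both maps send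
    that union into itself, and there both derivatives lie in \<open>[0, lam)\<close>.  By the change of variables
    formula each image has measure at most \<open>lam\<close> times that of \<open>K\<close>, so the measure \<open>m\<close> of \<open>K\<close> satisfies \<open>m \<le> 2 * lam * m\<close> with \<open>2 * lam < 1\<close>.  This
    tolerates overlaps between \<open>f ` K\<close> and \<open>g ` K\<close>, so \<open>K\<close> need not be a self-similar set of the
    usual separated kind.

  \<^item> There are no isolated points because \<open>0\<close> is a limit of its own orbit: the orbit of \<open>g 0\<close>
    consists of positive points and accumulates at \<open>0\<close>.  Injective words carry this
    accumulation to every point of the orbit of \<open>0\<close>, and taking closures does not create isolated
    points.

  The middle-thirds set is recognised by the same two properties, its measure being controlled by
  the same inequality, and both sets are then homeomorphic to \<open>nat \<Rightarrow> bool\<close> with the product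
  topology.
\<close>

section \<open>Brouwer's characterisation of the Cantor set on the line\<close>

definition cantor_like :: "real set \<Rightarrow> bool" where
  "cantor_like P \<longleftrightarrow> compact P \<and> P \<noteq> {} \<and> (\<forall>x\<in>P. x islimpt P) \<and> interior P = {}"

text \<open>A point outside \<open>P\<close> can be found in the middle third of the interval spanned by \<open>P\<close>.  Cutting
  there leaves two pieces of the same kind, so the construction can be iterated, and the diameters
  shrink geometrically.\<close>

lemma cantor_like_split:
  assumes "cantor_like P"
  obtains L R where "cantor_like L" "cantor_like R" "L \<union> R = P" "L \<inter> R = {}"
    "diameter L \<le> 2/3 * diameter P" "diameter R \<le> 2/3 * diameter P"
proof -
  have P: "compact P" "P \<noteq> {}" "\<And>x. x \<in> P \<Longrightarrow> x islimpt P" "interior P = {}"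
    using assms by (auto simp: cantor_like_def)
  have bdd: "bounded P" "closed P" using P(1) compact_eq_bounded_closed by auto
  define a b where "a = Inf P" and "b = Sup P"
  have ab: "a \<in> P" "b \<in> P" "\<And>x. x \<in> P \<Longrightarrow> a \<le> x \<and> x \<le> b"
    using bdd P(2) unfolding a_def b_def
    by (auto intro: closed_contains_Inf closed_contains_Sup bounded_imp_bdd_below
        bounded_imp_bdd_above cInf_lower cSup_upper)
  obtain y where "y \<in> P" "y \<noteq> a"
    using P(3)[OF ab(1)] unfolding islimpt_approachable by (meson zero_less_one)
  hence "a < b" using ab(3)[of y] by linarith
  have "\<not> {a + (b - a)/3 <..< b - (b - a)/3} \<subseteq> P"
  proof
    assume "{a + (b - a)/3 <..< b - (b - a)/3} \<subseteq> P"
    hence "{a + (b - a)/3 <..< b - (b - a)/3} \<subseteq> interior P"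
      by (rule interior_maximal) simp
    moreover have "(a + b)/2 \<in> {a + (b - a)/3 <..< b - (b - a)/3}"
      using \<open>a < b\<close> by (simp add: field_simps)
    ultimately show False using P(4) by blast
  qed
  then obtain c where "c \<in> {a + (b - a)/3 <..< b - (b - a)/3}" "c \<notin> P" by blast
  hence c: "c \<notin> P" "a + (b - a)/3 < c" "c < b - (b - a)/3" by simp_all
  have ac: "a < c" "c < b" using c \<open>a < b\<close> by (auto simp: field_simps)
  have lim: "x islimpt P \<inter> T" if "x \<in> P" "open T" "x \<in> T" for x T
    by (intro islimpt_Int_eventually P(3) that) (use that eventually_at_topological in blast)
  have diam: "b - a \<le> diameter P"
    using diameter_bounded_bound[OF bdd(1) ab(2,1)] \<open>a < b\<close> by (simp add: dist_real_def)
  have less: "P \<inter> {..c} = P \<inter> {..<c}" and greater: "P \<inter> {c..} = P \<inter> {c<..}"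
    using c(1) by (auto simp: order.strict_iff_order)
  have compact: "compact (P \<inter> {..c})" "compact (P \<inter> {c..})"
    using P(1) by (auto intro: compact_Int_closed)
  show thesis
  proof (rule that[of "P \<inter> {..c}" "P \<inter> {c..}"])
    have "x islimpt P \<inter> {..<c}" if "x \<in> P \<inter> {..<c}" for x
      using that lim[of x "{..<c}"] by auto
    then show "cantor_like (P \<inter> {..c})"
      unfolding cantor_like_def using compact P(4) ab ac less by auto
    have "x islimpt P \<inter> {c<..}" if "x \<in> P \<inter> {c<..}" for x
      using that lim[of x "{c<..}"] by auto
    then show "cantor_like (P \<inter> {c..})"
      unfolding cantor_like_def using compact P(4) ab ac greater by auto
    show "P \<inter> {..c} \<union> P \<inter> {c..} = P" by auto
    show "P \<inter> {..c} \<inter> (P \<inter> {c..}) = {}" using c(1) by auto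
    have "diameter (P \<inter> {..c}) \<le> c - a"
      using ac ab(3) by (intro diameter_le) (force simp: abs_le_iff)+
    also have "\<dots> \<le> 2/3 * (b - a)" using c by (simp add: field_simps)
    finally show "diameter (P \<inter> {..c}) \<le> 2/3 * diameter P" using diam by simp
    have "diameter (P \<inter> {c..}) \<le> b - c"
      using ac ab(3) by (intro diameter_le) (force simp: abs_le_iff)+
    also have "\<dots> \<le> 2/3 * (b - a)" using c by (simp add: field_simps)
    finally show "diameter (P \<inter> {c..}) \<le> 2/3 * diameter P" using diam by simp
  qed
qed

primrec branch_piece :: "('a set \<Rightarrow> 'a set) \<Rightarrow> ('a set \<Rightarrow> 'a set) \<Rightarrow> 'a set \<Rightarrow> (nat \<Rightarrow> bool) \<Rightarrow> nat \<Rightarrow> 'a set"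
where
  "branch_piece l r K s 0 = K"
| "branch_piece l r K s (Suc n) =
     (if s n then r (branch_piece l r K s n) else l (branch_piece l r K s n))"

lemma branch_piece_cong:
  assumes "\<And>i. i < n \<Longrightarrow> s i = t i"
  shows "branch_piece l r K s n = branch_piece l r K t n"
  using assms by (induction n) auto

lemma compact_UNIV_nat_bool: "compact (UNIV :: (nat \<Rightarrow> bool) set)"
proof -
  have "compact_space (euclidean :: bool topology)"
    by (simp add: compact_space_def finite_imp_compact)
  hence "compact_space (product_topology (\<lambda>_::nat. euclidean :: bool topology) UNIV)"
    unfolding compact_space_product_topology by blast
  thus ?thesis
    by (simp add: euclidean_product_topology compact_space_def)
qed

text \<open>Repeated cutting assigns to each binary sequence a shrinking chain of compact pieces, hence a
  point; nearby sequences share their first pieces, which gives continuity, and compactness of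
  \<open>nat \<Rightarrow> bool\<close> does the rest.\<close>

theorem cantor_like_homeomorphic_nat_bool:
  assumes "cantor_like K"
  shows "(UNIV :: (nat \<Rightarrow> bool) set) homeomorphic K"
proof -
  define splits where "splits P L R \<longleftrightarrow> cantor_like L \<and> cantor_like R \<and> L \<union> R = P \<and> L \<inter> R = {}
      \<and> diameter L \<le> 2/3 * diameter P \<and> diameter R \<le> 2/3 * diameter P" for P L R
  have "\<exists>LR. cantor_like P \<longrightarrow> splits P (fst LR) (snd LR)" for P
  proof (cases "cantor_like P")
    case True
    then obtain L R where "splits P L R"
      unfolding splits_def by (rule cantor_like_split) blast
    thus ?thesis by (intro exI[of _ "(L, R)"]) simp
  qed blast
  then obtain LR where LR: "\<And>P. cantor_like P \<longrightarrow> splits P (fst (LR P)) (snd (LR P))" by metis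
  define l r where "l P = fst (LR P)" and "r P = snd (LR P)" for P
  have "\<And>P. cantor_like P \<Longrightarrow> splits P (l P) (r P)" using LR by (simp add: l_def r_def)
  hence lr: "\<And>P. cantor_like P \<Longrightarrow> cantor_like (l P) \<and> cantor_like (r P) \<and> l P \<union> r P = P
      \<and> l P \<inter> r P = {} \<and> diameter (l P) \<le> 2/3 * diameter P \<and> diameter (r P) \<le> 2/3 * diameter P"
    unfolding splits_def by blast
  define p where "p = branch_piece l r K"
  have p_simps: "p s 0 = K" "p s (Suc n) = (if s n then r (p s n) else l (p s n))" for s n
    by (simp_all add: p_def)
  have cl: "cantor_like (p s n)" for s n
    by (induction n) (auto simp: p_simps assms lr)
  have dec: "p s (Suc n) \<subseteq> p s n" for s n
    using lr[OF cl[of s n]] by (auto simp: p_simps)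
  have anti: "p s n \<subseteq> p s m" if "m \<le> n" for s m n
    using that by (induction rule: dec_induct) (use dec in auto)
  have diam: "diameter (p s n) \<le> (2/3)^n * diameter K" for s n
  proof (induction n)
    case (Suc n)
    have "diameter (p s (Suc n)) \<le> 2/3 * diameter (p s n)"
      using lr[OF cl[of s n]] by (simp add: p_simps)
    with Suc show ?case by simp
  qed (simp add: p_simps)
  have close: "\<exists>n. \<forall>s. \<forall>x\<in>p s n. \<forall>y\<in>p s n. dist x y < e" if "e > 0" for e
  proof -
    have "(\<lambda>n. (2/3)^n * diameter K) \<longlonglongrightarrow> 0 * diameter K"
      by (intro tendsto_mult LIMSEQ_power_zero tendsto_const) simp
    hence "\<forall>\<^sub>F n in sequentially. (2/3)^n * diameter K < e"
      using that by (intro order_tendstoD(2)[where y = 0]) auto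
    then obtain n where n: "(2/3)^n * diameter K < e"
      by (auto simp: eventually_sequentially)
    have "dist x y < e" if "x \<in> p s n" "y \<in> p s n" for s x y
    proof -
      have "bounded (p s n)" using cl[of s n] by (simp add: cantor_like_def compact_imp_bounded)
      from diameter_bounded_bound[OF this that] diam[of s n] n show ?thesis by simp
    qed
    thus ?thesis by blast
  qed
  have "\<Inter> (range (p s)) \<noteq> {}" for s
  proof (rule compact_nest)
    show "compact (p s n)" "p s n \<noteq> {}" for n using cl[of s n] by (auto simp: cantor_like_def)
    show "p s n \<subseteq> p s m" if "m \<le> n" for m n using anti that .
  qed
  hence "\<forall>s. \<exists>x. \<forall>n. x \<in> p s n" by blast
  then obtain h where h: "\<And>s n. h s \<in> p s n" by metis
  have inj: "inj h"
  proof (rule injI, rule ccontr)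
    fix s t assume eq: "h s = h t" and "s \<noteq> t"
    then obtain n where n: "s n \<noteq> t n" "\<And>i. i < n \<Longrightarrow> s i = t i"
      using exists_least_iff[of "\<lambda>n. s n \<noteq> t n"] by auto
    hence "p s n = p t n" unfolding p_def by (intro branch_piece_cong)
    hence "p s (Suc n) \<inter> p t (Suc n) = {}"
      using lr[OF cl[of s n]] n(1) by (auto simp: p_simps)
    with h[of s "Suc n"] h[of t "Suc n"] eq show False by auto
  qed
  have surj: "range h = K"
  proof
    show "range h \<subseteq> K" using h[of _ 0] by (auto simp: p_simps)
    show "K \<subseteq> range h"
    proof
      fix x assume "x \<in> K"
      \<comment> \<open>the itinerary of \<open>x\<close>: always descend into the piece that contains \<open>x\<close>\<close>
      define q where "q = rec_nat K (\<lambda>_ P. if x \<in> r P then r P else l P)"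
      define s where "s n \<longleftrightarrow> x \<in> r (q n)" for n
      have q: "q n = p s n" for n
        by (induction n) (auto simp: q_def s_def p_simps)
      have x: "x \<in> p s n" for n
      proof (induction n)
        case (Suc n)
        hence "x \<in> l (p s n) \<union> r (p s n)" using lr[OF cl[of s n]] by blast
        moreover have "s n \<longleftrightarrow> x \<in> r (p s n)" by (simp add: s_def q)
        ultimately show ?case by (auto simp: p_simps)
      qed (simp add: \<open>x \<in> K\<close> p_simps)
      have "dist x (h s) < e" if "e > 0" for e
        using close[OF that] x h by blast
      hence "x = h s" by (metis less_irrefl zero_less_dist_iff)
      thus "x \<in> range h" by blast
    qed
  qed
  have "continuous_on UNIV h"
    unfolding continuous_on_def
  proof
    fix s
    show "(h \<longlongrightarrow> h s) (at s)"
    proof (rule tendstoI)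
      fix e :: real assume "e > 0"
      from close[OF this] obtain n where n: "\<And>s x y. x \<in> p s n \<Longrightarrow> y \<in> p s n \<Longrightarrow> dist x y < e"
        by blast
      define T where "T = (\<Inter>i\<in>{..<n}. (\<lambda>t. t i) -` {s i})"
      have "open T" unfolding T_def
        by (intro open_INT ballI open_vimage continuous_on_product_coordinates)
           (auto simp: open_discrete)
      moreover have "s \<in> T" by (simp add: T_def)
      moreover have "dist (h t) (h s) < e" if "t \<in> T" for t
      proof -
        have "p t n = p s n"
          unfolding p_def by (rule branch_piece_cong) (use that in \<open>auto simp: T_def\<close>)
        thus ?thesis using n h by metis
      qed
      ultimately show "\<forall>\<^sub>F t in at s. dist (h t) (h s) < e"
        unfolding eventually_at_topological by blast
    qed
  qed
  from homeomorphic_compact[OF compact_UNIV_nat_bool this surj inj] show ?thesis .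
qed

corollary cantor_like_homeomorphic:
  assumes "cantor_like K" "cantor_like L"
  shows "K homeomorphic L"
  using cantor_like_homeomorphic_nat_bool[OF assms(1)] cantor_like_homeomorphic_nat_bool[OF assms(2)]
  by (meson homeomorphic_sym homeomorphic_trans)


section \<open>Sets covered by two contracted copies of themselves\<close>

lemma measure_contracted_image_le:
  fixes h :: "real \<Rightarrow> real"
  assumes S: "compact S" and der: "\<And>x. x \<in> S \<Longrightarrow> (h has_real_derivative D x) (at x within S)"
    and inj: "inj_on h S" and bound: "\<And>x. x \<in> S \<Longrightarrow> \<bar>D x\<bar> \<le> c"
  shows "measure lebesgue (h ` S) \<le> c * measure lebesgue S"
proof -
  have meas: "S \<in> lmeasurable" "h ` S \<in> lmeasurable"
    using S der by (auto intro!: lmeasurable_compact compact_continuous_image DERIV_continuous_on)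
  have "(\<lambda>x. 1::real) absolutely_integrable_on h ` S"
    using meas(2) by (simp add: lmeasurable_iff_integrable_on absolutely_integrable_on_iff_nonneg)
  with has_absolute_integral_change_of_variables_1'[OF _ der inj, where f = "\<lambda>_. 1"
      and b = "integral (h ` S) (\<lambda>_. 1)"] meas
  have cov: "(\<lambda>x. \<bar>D x\<bar>) absolutely_integrable_on S"
    "integral S (\<lambda>x. \<bar>D x\<bar>) = integral (h ` S) (\<lambda>_. 1)"
    by (auto simp: fmeasurableD)
  have "measure lebesgue (h ` S) = integral S (\<lambda>x. \<bar>D x\<bar>)"
    using cov(2) lmeasure_integral[OF meas(2)] by simp
  also have "\<dots> \<le> integral S (\<lambda>x. c * 1)"
  proof (rule integral_le)
    show "(\<lambda>x. \<bar>D x\<bar>) integrable_on S"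
      using cov(1) set_lebesgue_integral_eq_integral(1) by blast
    show "(\<lambda>x. c * 1) integrable_on S"
      using meas(1) unfolding lmeasurable_iff_integrable_on by (rule integrable_on_mult_right)
  qed (use bound in simp)
  also have "\<dots> = c * measure lebesgue S"
    by (simp only: lmeasure_integral[OF meas(1)] integral_mult_right)
  finally show ?thesis .
qed

text \<open>By subadditivity \<open>m \<le> 2 * c * m\<close> for the measure \<open>m\<close> of \<open>K\<close>, whether or not the copies
  overlap; so \<open>K\<close> is Lebesgue null and contains no interval.\<close>

lemma interior_empty_of_contracted_copies:
  fixes f g :: "real \<Rightarrow> real"
  assumes K: "compact K" "K \<subseteq> f ` K \<union> g ` K"
    and f: "\<And>x. x \<in> K \<Longrightarrow> (f has_real_derivative Df x) (at x within K)" "inj_on f K"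
      "\<And>x. x \<in> K \<Longrightarrow> \<bar>Df x\<bar> \<le> c"
    and g: "\<And>x. x \<in> K \<Longrightarrow> (g has_real_derivative Dg x) (at x within K)" "inj_on g K"
      "\<And>x. x \<in> K \<Longrightarrow> \<bar>Dg x\<bar> \<le> c"
    and c: "c < 1/2"
  shows "interior K = {}"
proof -
  let ?m = "measure lebesgue"
  have meas: "K \<in> lmeasurable" "f ` K \<in> lmeasurable" "g ` K \<in> lmeasurable"
    using K(1) f(1) g(1)
    by (auto intro!: lmeasurable_compact compact_continuous_image DERIV_continuous_on)
  have "?m K \<le> ?m (f ` K \<union> g ` K)"
    using meas K(2) by (intro measure_mono_fmeasurable) (auto simp: fmeasurableD)
  also have "\<dots> \<le> ?m (f ` K) + ?m (g ` K)"
    using meas by (intro measure_Un_le) (auto simp: fmeasurableD)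
  also have "\<dots> \<le> c * ?m K + c * ?m K"
    using measure_contracted_image_le[OF K(1) f] measure_contracted_image_le[OF K(1) g] by simp
  finally have "(1 - 2 * c) * ?m K \<le> 0" by (simp add: algebra_simps)
  hence "?m K \<le> 0" using c by (simp add: mult_le_0_iff)
  hence "negligible K"
    using meas(1) measure_nonneg[of lebesgue K] by (simp add: negligible_iff_measure)
  hence "negligible (interior K)" by (rule negligible_subset) (rule interior_subset)
  thus ?thesis using open_not_negligible open_interior by blast
qed


section \<open>The middle-thirds set\<close>

lemma cantor_stage_subset: "cantor_stage n \<subseteq> {0..1}"
  by (induction n) force+

lemma cantor_set_self_similar:
  "cantor_set = (\<lambda>x. x / 3) ` cantor_set \<union> (\<lambda>x. 2 / 3 + x / 3) ` cantor_set"
proof (intro equalityI subsetI)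
  fix x assume x: "x \<in> cantor_set"
  hence stage: "x \<in> (\<lambda>x. x / 3) ` cantor_stage n \<union> (\<lambda>x. 2 / 3 + x / 3) ` cantor_stage n" for n
    unfolding cantor_set_def by (metis INT_D UNIV_I cantor_stage.simps(2))
  show "x \<in> (\<lambda>x. x / 3) ` cantor_set \<union> (\<lambda>x. 2 / 3 + x / 3) ` cantor_set"
  proof (cases "x < 2/3")
    case True
    have "3 * x \<in> cantor_stage n" for n
      using stage[of n] True cantor_stage_subset[of n] by force
    hence "3 * x \<in> cantor_set" by (auto simp: cantor_set_def)
    thus ?thesis by (force intro: image_eqI[of _ _ "3 * x"])
  next
    case False
    have "3 * x - 2 \<in> cantor_stage n" for n
      using stage[of n] False cantor_stage_subset[of n] by (force simp: field_simps)
    hence "3 * x - 2 \<in> cantor_set" by (auto simp: cantor_set_def)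
    thus ?thesis by (force simp: field_simps intro: image_eqI[of _ _ "3 * x - 2"])
  qed
next
  fix x assume x: "x \<in> (\<lambda>x. x / 3) ` cantor_set \<union> (\<lambda>x. 2 / 3 + x / 3) ` cantor_set"
  have "x \<in> cantor_stage n" for n
  proof (cases n)
    case 0
    have "cantor_set \<subseteq> {0..1}" unfolding cantor_set_def using cantor_stage_subset by blast
    with x 0 show ?thesis by force
  next
    case (Suc m)
    have "cantor_set \<subseteq> cantor_stage m" unfolding cantor_set_def by blast
    with x Suc show ?thesis by auto
  qed
  thus "x \<in> cantor_set" by (simp add: cantor_set_def)
qed

lemma cantor_set_endpoints: "0 \<in> cantor_set" "1 \<in> cantor_set"
proof -
  have "0 \<in> cantor_stage n \<and> 1 \<in> cantor_stage n" for n
    by (induction n) (auto intro: image_eqI[of _ _ 0] image_eqI[of _ _ 1])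
  thus "0 \<in> cantor_set" "1 \<in> cantor_set" by (auto simp: cantor_set_def)
qed

text \<open>Shrinking the pair of end points by the self-similarity produces a second point of the set at
  distance at most \<open>3 ^ - n\<close> from any given one.\<close>

lemma cantor_set_near_point:
  assumes "x \<in> cantor_set"
  shows "\<exists>y\<in>cantor_set. y \<noteq> x \<and> dist y x \<le> (1/3)^n"
  using assms
proof (induction n arbitrary: x)
  case 0
  have "x \<in> {0..1}" using 0 cantor_stage_subset unfolding cantor_set_def by blast
  thus ?case using cantor_set_endpoints
    by (intro bexI[of _ "if x = 0 then 1 else 0"]) (auto simp: dist_real_def)
next
  case (Suc n)
  have lift: "\<exists>y\<in>cantor_set. y \<noteq> x \<and> dist y x \<le> (1/3)^Suc n"
    if z: "x = a + z / 3" "z \<in> cantor_set" "(\<lambda>u. a + u / 3) ` cantor_set \<subseteq> cantor_set" for a z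
  proof -
    obtain y where y: "y \<in> cantor_set" "y \<noteq> z" "dist y z \<le> (1/3)^n"
      using Suc.IH[OF z(2)] by blast
    have "dist (a + y / 3) x = dist y z / 3"
      by (simp add: z(1) dist_real_def flip: diff_divide_distrib)
    with y z show ?thesis by (intro bexI[of _ "a + y / 3"]) auto
  qed
  have copies: "(\<lambda>u. 0 + u / 3) ` cantor_set \<subseteq> cantor_set" "(\<lambda>u. 2/3 + u / 3) ` cantor_set \<subseteq> cantor_set"
    using cantor_set_self_similar by auto
  have "x \<in> (\<lambda>x. x / 3) ` cantor_set \<union> (\<lambda>x. 2 / 3 + x / 3) ` cantor_set"
    using Suc.prems cantor_set_self_similar by blast
  then obtain z where "z \<in> cantor_set" "x = 0 + z / 3 \<or> x = 2/3 + z / 3" by auto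
  thus ?case using lift copies by blast
qed

lemma cantor_like_cantor_set: "cantor_like cantor_set"
proof -
  have "compact (cantor_stage n)" for n
    by (induction n) (auto intro!: compact_Un compact_continuous_image continuous_intros)
  hence "closed cantor_set" unfolding cantor_set_def by (auto simp: compact_imp_closed)
  moreover have "cantor_set \<subseteq> {0..1}" unfolding cantor_set_def using cantor_stage_subset by blast
  ultimately have compact: "compact cantor_set"
    by (metis compact_Icc compact_Int_closed inf.absorb2)
  have "interior cantor_set = {}"
    by (rule interior_empty_of_contracted_copies[where c = "1/3" and Df = "\<lambda>_. 1/3"
          and Dg = "\<lambda>_. 1/3", OF compact equalityD1[OF cantor_set_self_similar]])
       (auto intro!: derivative_eq_intros inj_onI)
  moreover have "x islimpt cantor_set" if "x \<in> cantor_set" for x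
    unfolding islimpt_approachable
  proof (intro allI impI)
    fix e :: real assume "e > 0"
    then obtain n where "(1/3::real)^n < e" using real_arch_pow_inv[of e "1/3"] by auto
    thus "\<exists>y\<in>cantor_set. y \<noteq> x \<and> dist y x < e"
      using cantor_set_near_point[OF that, of n] by force
  qed
  ultimately show ?thesis
    using compact cantor_set_endpoints by (auto simp: cantor_like_def)
qed


section \<open>Orbits of a two-generator semigroup\<close>

lemma semigroup_gen_cases_left:
  assumes "\<phi> \<in> semigroup_gen f g"
  shows "\<phi> = f \<or> \<phi> = g \<or> (\<exists>\<psi>\<in>semigroup_gen f g. \<phi> = f \<circ> \<psi> \<or> \<phi> = g \<circ> \<psi>)"
  using assms
proof induction
  case (comp \<phi> \<psi>)
  show ?case
    using comp.IH(1)
  proof (elim disjE bexE)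
    fix \<eta> assume "\<eta> \<in> semigroup_gen f g" "\<phi> = f \<circ> \<eta>"
    with comp.hyps show ?thesis by (metis comp_assoc semigroup_gen.comp)
  next
    fix \<eta> assume "\<eta> \<in> semigroup_gen f g" "\<phi> = g \<circ> \<eta>"
    with comp.hyps show ?thesis by (metis comp_assoc semigroup_gen.comp)
  qed (use comp.hyps in blast)+
qed auto

lemma semigroup_gen_image_subset:
  assumes "\<phi> \<in> semigroup_gen f g" "f ` X \<subseteq> X" "g ` X \<subseteq> X"
  shows "\<phi> ` X \<subseteq> X"
  using assms by induction (auto simp: image_subset_iff)

lemma semigroup_gen_continuous_on:
  assumes "\<phi> \<in> semigroup_gen f g" "f ` X \<subseteq> X" "g ` X \<subseteq> X" "continuous_on X f" "continuous_on X g"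
  shows "continuous_on X \<phi>"
  using assms
proof induction
  case (comp \<phi> \<psi>)
  thus ?case using semigroup_gen_image_subset[OF comp.hyps(2)]
    by (metis continuous_on_compose continuous_on_subset)
qed

lemma semigroup_gen_inj_on:
  assumes "\<phi> \<in> semigroup_gen f g" "f ` X \<subseteq> X" "g ` X \<subseteq> X" "inj_on f X" "inj_on g X"
  shows "inj_on \<phi> X"
  using assms
proof induction
  case (comp \<phi> \<psi>)
  thus ?case using semigroup_gen_image_subset[OF comp.hyps(2)]
    by (metis comp_inj_on inj_on_subset)
qed

lemma forward_orbit_image_subset:
  assumes "\<phi> \<in> semigroup_gen f g"
  shows "\<phi> ` forward_orbit f g x \<subseteq> forward_orbit f g x"
proof
  fix y assume "y \<in> \<phi> ` forward_orbit f g x"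
  then obtain \<psi> where "\<psi> \<in> semigroup_gen f g" "y = (\<phi> \<circ> \<psi>) x"
    by (auto simp: forward_orbit_def)
  thus "y \<in> forward_orbit f g x"
    unfolding forward_orbit_def using semigroup_gen.comp[OF assms] by blast
qed

lemma forward_orbit_subset:
  assumes "x \<in> X" "f ` X \<subseteq> X" "g ` X \<subseteq> X"
  shows "forward_orbit f g x \<subseteq> X"
  using assms(1) semigroup_gen_image_subset[OF _ assms(2,3)]
  unfolding forward_orbit_def by blast

lemma forward_orbit_unfold:
  "forward_orbit f g x =
     {f x, g x} \<union> f ` forward_orbit f g x \<union> g ` forward_orbit f g x" (is "?O = ?R")
proof
  show "?O \<subseteq> ?R"
  proof
    fix y assume "y \<in> ?O"
    then obtain \<phi> where \<phi>: "\<phi> \<in> semigroup_gen f g" "y = \<phi> x" by (auto simp: forward_orbit_def)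
    have mem: "\<psi> x \<in> ?O" if "\<psi> \<in> semigroup_gen f g" for \<psi>
      using that by (auto simp: forward_orbit_def)
    from semigroup_gen_cases_left[OF \<phi>(1)] show "y \<in> ?R"
      using mem \<phi>(2) by auto
  qed
  show "?R \<subseteq> ?O"
    using forward_orbit_image_subset[of f f g x] forward_orbit_image_subset[of g f g x]
    by (auto simp: forward_orbit_def intro: semigroup_gen.intros)
qed

lemma closure_forward_orbit_invariant:
  fixes X :: "real set"
  assumes X: "closed X" "f ` X \<subseteq> X" "g ` X \<subseteq> X" "continuous_on X f" "continuous_on X g"
    and x: "x \<in> X" and \<phi>: "\<phi> \<in> semigroup_gen f g"
  shows "\<phi> ` closure (forward_orbit f g x) \<subseteq> closure (forward_orbit f g x)"
proof (rule image_closure_subset)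
  have "closure (forward_orbit f g x) \<subseteq> X"
    using forward_orbit_subset[OF x X(2,3)] X(1) by (rule closure_minimal)
  thus "continuous_on (closure (forward_orbit f g x)) \<phi>"
    using semigroup_gen_continuous_on[OF \<phi> X(2-5)] continuous_on_subset by blast
  show "\<phi> ` forward_orbit f g x \<subseteq> closure (forward_orbit f g x)"
    using forward_orbit_image_subset[OF \<phi>] closure_subset by blast
qed simp

lemma closure_forward_orbit_subset:
  fixes X :: "real set"
  assumes X: "closed X" "f ` X \<subseteq> X" "g ` X \<subseteq> X" "continuous_on X f" "continuous_on X g"
    and x: "x \<in> X" and y: "y \<in> closure (forward_orbit f g x)"
  shows "closure (forward_orbit f g y) \<subseteq> closure (forward_orbit f g x)"
proof (rule closure_minimal)
  show "forward_orbit f g y \<subseteq> closure (forward_orbit f g x)"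
    using closure_forward_orbit_invariant[OF X x] y
    by (intro forward_orbit_subset) (auto intro: semigroup_gen.intros)
qed simp


section \<open>The minimal set\<close>

lemma class_A_facts:
  assumes "(f, g) \<in> class_A"
  shows "f ` {0..1} \<subseteq> {0..1}" "g ` {0..1} \<subseteq> {0..1}" "continuous_on {0..1} f" "continuous_on {0..1} g"
    "inj_on f {0..1}" "inj_on g {0..1}" "f 0 = 0" "g 1 = 1" "0 < g 0" "g 0 < f 1" "f 1 < 1"
    "\<And>x. 0 < x \<Longrightarrow> x < 1 \<Longrightarrow> f x < x" "\<And>x. 0 < x \<Longrightarrow> x < 1 \<Longrightarrow> x < g x"
  using assms unfolding class_A_def Diff1_im_def C1_within_def
  by (auto intro: DERIV_continuous_on)

text \<open>The least element \<open>m\<close> of an orbit closure satisfies \<open>m \<le> f m\<close>, which only the fixed point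
  \<open>0\<close> of \<open>f\<close> does.\<close>

lemma zero_in_closure_forward_orbit:
  assumes A: "(f, g) \<in> class_A" and x: "x \<in> {0..1}"
  shows "0 \<in> closure (forward_orbit f g x)"
proof -
  note A = class_A_facts[OF A]
  let ?C = "closure (forward_orbit f g x)"
  have C: "?C \<subseteq> {0..1}"
    using forward_orbit_subset[OF x A(1,2)] by (rule closure_minimal) simp
  have ne: "?C \<noteq> {}"
    using semigroup_gen.fst_gen[of f g] by (auto simp: forward_orbit_def)
  have bdd: "bdd_below ?C" using C by (meson bdd_below_Icc bdd_below_mono)
  have m: "Inf ?C \<in> ?C" using ne bdd by (intro closed_contains_Inf) auto
  have "f ` ?C \<subseteq> ?C"
    by (rule closure_forward_orbit_invariant[OF closed_atLeastAtMost A(1-4) x semigroup_gen.fst_gen])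
  hence "f (Inf ?C) \<in> ?C" using m by blast
  hence "Inf ?C \<le> f (Inf ?C)" using bdd by (rule cInf_lower)
  moreover have "Inf ?C \<in> {0..1}" using m C by blast
  ultimately have "Inf ?C = 0"
    using A(11) A(12)[of "Inf ?C"] by (cases "Inf ?C = 1") force+
  thus ?thesis using m by simp
qed

lemma minimal_set_iff:
  assumes A: "(f, g) \<in> class_A"
  shows "minimal_set f g K \<longleftrightarrow> K = closure (forward_orbit f g 0)"
proof -
  note A' = class_A_facts[OF A]
  let ?O = "closure (forward_orbit f g 0)"
  have sub: "closure (forward_orbit f g y) \<subseteq> closure (forward_orbit f g x)"
    if "x \<in> {0..1}" "y \<in> closure (forward_orbit f g x)" for x y
    using that by (rule closure_forward_orbit_subset[OF closed_atLeastAtMost A'(1-4)])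
  have O: "?O \<subseteq> {0..1}"
    using forward_orbit_subset[OF _ A'(1,2), of 0] by (intro closure_minimal) auto
  show ?thesis
  proof
    assume K: "minimal_set f g K"
    then obtain x where x: "x \<in> K" "x \<in> {0..1}" unfolding minimal_set_def by blast
    hence "closure (forward_orbit f g x) = K" using K by (auto simp: minimal_set_def)
    hence "0 \<in> K" using zero_in_closure_forward_orbit[OF A x(2)] by simp
    thus "K = ?O" using K by (auto simp: minimal_set_def)
  next
    assume K: "K = ?O"
    have "closure (forward_orbit f g x) = ?O" if "x \<in> ?O" for x
    proof
      show "closure (forward_orbit f g x) \<subseteq> ?O" using sub[of 0] that by simp
      have "x \<in> {0..1}" using that O by blast
      thus "?O \<subseteq> closure (forward_orbit f g x)"
        using sub zero_in_closure_forward_orbit[OF A] by blast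
    qed
    moreover have "?O \<noteq> {}" using zero_in_closure_forward_orbit[OF A, of 0] by fastforce
    ultimately show "minimal_set f g K"
      unfolding minimal_set_def K using O by blast
  qed
qed

text \<open>The orbit of \<open>g 0\<close> stays positive and accumulates at \<open>0\<close>; the words of the semigroup,
  being continuous and injective, transport this accumulation along the orbit of \<open>0\<close>.\<close>

lemma minimal_set_no_isolated_points:
  assumes A: "(f, g) \<in> class_A" and x: "x \<in> closure (forward_orbit f g 0)"
  shows "x islimpt closure (forward_orbit f g 0)"
proof -
  note A' = class_A_facts[OF A]
  let ?O = "forward_orbit f g 0" and ?P = "forward_orbit f g (g 0)"
  have g0: "g 0 \<in> ?O" "g 0 \<in> {0<..1}" "g 0 \<in> {0..1}"
    using A' by (auto simp: forward_orbit_def intro: semigroup_gen.intros)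
  have "f ` {0<..1} \<subseteq> {0<..1}"
  proof
    fix y assume "y \<in> f ` {0<..1}"
    then obtain t where t: "y = f t" "0 < t" "t \<le> 1" by auto
    have "f t \<noteq> f 0" using t inj_onD[OF A'(5), of t 0] by auto
    moreover have "f t \<in> {0..1}" by (rule subsetD[OF A'(1)], rule imageI) (use t in auto)
    ultimately show "y \<in> {0<..1}" using t A'(7) by auto
  qed
  moreover have "g ` {0<..1} \<subseteq> {0<..1}"
  proof
    fix y assume "y \<in> g ` {0<..1}"
    then obtain t where t: "y = g t" "0 < t" "t \<le> 1" by auto
    moreover have "g t \<in> {0..1}" by (rule subsetD[OF A'(2)], rule imageI) (use t in auto)
    ultimately show "y \<in> {0<..1}" using A'(13)[of t] A'(8) by (cases "t = 1") auto
  qed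
  ultimately have P: "?P \<subseteq> {0<..1}" using g0 by (intro forward_orbit_subset)
  have "?P \<subseteq> ?O"
    using forward_orbit_image_subset[of _ f g 0] g0(1)
    by (intro forward_orbit_subset) (auto intro: semigroup_gen.intros)
  have "0 islimpt ?P"
    using zero_in_closure_forward_orbit[OF A g0(3)] P by (auto simp: closure_def)
  then obtain u where u: "\<And>n. u n \<in> ?P" "\<And>n. u n \<noteq> 0" "u \<longlonglongrightarrow> 0"
    unfolding islimpt_sequential by auto
  have lim: "z islimpt ?O" if "z \<in> ?O" for z
  proof -
    obtain \<phi> where \<phi>: "\<phi> \<in> semigroup_gen f g" "z = \<phi> 0" using \<open>z \<in> ?O\<close>
      by (auto simp: forward_orbit_def)
    have u01: "u n \<in> {0..1}" for n using u(1)[of n] P by force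
    have "continuous_on {0..1} \<phi>" "inj_on \<phi> {0..1}"
      using \<phi> A' by (auto intro: semigroup_gen_continuous_on semigroup_gen_inj_on)
    hence "(\<lambda>n. \<phi> (u n)) \<longlonglongrightarrow> z" "\<And>n. \<phi> (u n) \<noteq> z"
      using u u01 \<phi>(2)
      by (auto intro!: continuous_on_tendsto_compose[of "{0..1}" \<phi>] dest: inj_onD)
    moreover have "\<phi> (u n) \<in> ?O" for n
      using u(1)[of n] \<open>?P \<subseteq> ?O\<close> forward_orbit_image_subset[OF \<phi>(1), of 0] by blast
    ultimately show ?thesis unfolding islimpt_sequential by (intro exI[of _ "\<lambda>n. \<phi> (u n)"]) auto
  qed
  have "x islimpt ?O" using x lim by (auto simp: closure_def)
  thus ?thesis by (rule islimpt_subset) (rule closure_subset)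
qed

text \<open>Every orbit point is an image of \<open>0\<close> or of another orbit point, and \<open>0\<close> itself lies in the
  closure; the images of the closure are compact, so limits of orbit points are covered as well.\<close>

lemma closure_orbit_zero_subset_images:
  assumes A: "(f, g) \<in> class_A"
  defines "K \<equiv> closure (forward_orbit f g 0)"
  shows "K \<subseteq> f ` K \<union> g ` K"
  unfolding K_def
proof (rule closure_minimal)
  note A' = class_A_facts[OF A]
  let ?O = "forward_orbit f g 0"
  have O: "closure ?O \<subseteq> {0..1}"
    using forward_orbit_subset[OF _ A'(1,2), of 0] by (intro closure_minimal) auto
  hence "compact (closure ?O)"
    by (metis bounded_closed_interval bounded_subset closed_closure compact_eq_bounded_closed)
  thus "closed (f ` closure ?O \<union> g ` closure ?O)"
    using O A'(3,4)
    by (intro closed_Un compact_imp_closed compact_continuous_image) (auto intro: continuous_on_subset)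
  have "0 \<in> closure ?O" using zero_in_closure_forward_orbit[OF A] by simp
  thus "?O \<subseteq> f ` closure ?O \<union> g ` closure ?O"
    using forward_orbit_unfold[of f g 0] closure_subset[of ?O] by blast
qed

text \<open>At an end point of \<open>{0..1}\<close> only one-sided increments are available, hence the two cases in
  the proof.\<close>

lemma strict_mono_on_unit_interval_deriv_nonneg:
  fixes h :: "real \<Rightarrow> real"
  assumes mono: "\<And>x y. 0 \<le> x \<Longrightarrow> x < y \<Longrightarrow> y \<le> 1 \<Longrightarrow> h x < h y"
    and der: "(h has_real_derivative D) (at x within {0..1})" and x: "x \<in> {0..1}"
  shows "0 \<le> D"
proof (rule ccontr)
  assume "\<not> 0 \<le> D"
  hence D: "D < 0" by simp
  show False
  proof (cases "x < 1")
    case True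
    obtain d where d: "d > 0" "\<And>t. t > 0 \<Longrightarrow> x + t \<in> {0..1} \<Longrightarrow> t < d \<Longrightarrow> h x > h (x + t)"
      using has_real_derivative_neg_dec_right[OF der D] by blast
    define t where "t = min (d/2) (1 - x)"
    have "0 < t" "t < d" "x + t \<le> 1" using d(1) True by (auto simp: t_def)
    thus False using d(2)[of t] mono[of x "x + t"] x by auto
  next
    case False
    obtain d where d: "d > 0" "\<And>t. t > 0 \<Longrightarrow> x - t \<in> {0..1} \<Longrightarrow> t < d \<Longrightarrow> h x < h (x - t)"
      using has_real_derivative_neg_dec_left[OF der D] by blast
    define t where "t = min (d/2) x"
    have "0 < t" "t < d" "0 \<le> x - t" using d(1) x False by (auto simp: t_def)
    thus False using d(2)[of t] mono[of "x - t" x] x by auto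
  qed
qed

text \<open>An injective \<open>C\<^sup>1\<close> map of the interval whose end values are in order is increasing, so a one-sided
  bound on its derivative is a bound on the absolute value.\<close>

lemma Diff1_im_abs_derivative:
  assumes h: "h \<in> Diff1_im" "h 0 < h 1"
  obtains D where "\<And>x. x \<in> {0..1} \<Longrightarrow> (h has_real_derivative D x) (at x within {0..1})"
    "\<And>x. x \<in> {0..1} \<Longrightarrow> \<bar>D x\<bar> = vector_derivative h (at x within {0..1})"
proof -
  obtain D where D: "\<And>x. x \<in> {0..1} \<Longrightarrow> (h has_real_derivative D x) (at x within {0..1})"
    using h(1) unfolding Diff1_im_def C1_within_def by blast
  have cont: "continuous_on {0..1} h" using D by (rule DERIV_continuous_on)
  have inj: "inj_on h {0..1}" using h(1) by (simp add: Diff1_im_def)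
  \<comment> \<open>on each triple \<open>h\<close> preserves or reverses the order; comparison with \<open>0\<close> and \<open>1\<close> excludes
    reversal\<close>
  have increasing: "h a < h c" if "0 \<le> a" "a < c" "c \<le> 1" for a c
  proof -
    have step: "h u < h v \<and> h v < h w \<or> h w < h v \<and> h v < h u"
      if "0 \<le> u" "u < v" "v < w" "w \<le> 1" for u v w
      using continuous_inj_imp_mono[of u v w h] that cont inj
      by (meson atLeastatMost_subset_iff continuous_on_subset inj_on_subset less_le_not_le)
    show ?thesis
      using step[of 0 a c] step[of a c 1] step[of 0 a 1] step[of 0 c 1] that h(2)
      by (cases "a = 0"; cases "c = 1") force+
  qed
  have "0 \<le> D x" if "x \<in> {0..1}" for x
    using strict_mono_on_unit_interval_deriv_nonneg[OF increasing D that] that by blast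
  moreover have "vector_derivative h (at x within {0..1}) = D x" if "x \<in> {0..1}" for x
    using vector_derivative_within_closed_interval[of 0 1 x h "D x"] D[OF that] that
    by (simp add: has_real_derivative_iff_has_vector_derivative)
  ultimately show thesis using D by (intro that[of D]) simp_all
qed

theorem proposition7:
  fixes \<epsilon> lam :: real and f g :: "real \<Rightarrow> real" and Ineg1 I0 I1 :: "real set"
  assumes "0 < \<epsilon>" "\<epsilon> < 1/6" and "0 < lam" "lam < 1/2"
    and "Ineg1 = {0..1/3 - \<epsilon>}" and "I0 = {1/3 + \<epsilon>..2/3 - \<epsilon>}" and "I1 = {2/3 + \<epsilon>..1}"
    and "(f, g) \<in> class_A"
    and "f ` Ineg1 \<subseteq> Ineg1" and "f ` I0 \<subseteq> interior Ineg1" and "f ` I1 \<subseteq> interior I0"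
    and "g ` I1 \<subseteq> I1" and "g ` I0 \<subseteq> interior I1" and "g ` Ineg1 \<subseteq> interior I0"
    and "\<forall>x \<in> Ineg1 \<union> I0 \<union> I1. vector_derivative f (at x within {0..1}) < lam"
    and "\<forall>x \<in> Ineg1 \<union> I0 \<union> I1. vector_derivative g (at x within {0..1}) < lam"
  shows "(\<exists>!K. minimal_set f g K) \<and> (\<forall>K. minimal_set f g K \<longrightarrow> K homeomorphic cantor_set)"
proof -
  note A = class_A_facts[OF assms(8)]
  define U where "U = Ineg1 \<union> I0 \<union> I1"
  define K where "K = closure (forward_orbit f g 0)"
  have U: "closed U" "U \<subseteq> {0..1}" "0 \<in> U"
    using assms(1,2) by (auto simp: U_def assms(5-7))
  have "f ` U \<subseteq> U"
    using assms(9) subset_trans[OF assms(10) interior_subset]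
      subset_trans[OF assms(11) interior_subset] by (auto simp: U_def)
  moreover have "g ` U \<subseteq> U"
    using assms(12) subset_trans[OF assms(13) interior_subset]
      subset_trans[OF assms(14) interior_subset] by (auto simp: U_def)
  ultimately have KU: "K \<subseteq> U"
    unfolding K_def using U forward_orbit_subset[of 0 U f g] by (intro closure_minimal) auto
  with U(2) have K01: "K \<subseteq> {0..1}" by blast
  have "compact K"
    using K01 unfolding K_def
    by (metis bounded_closed_interval bounded_subset closed_closure compact_eq_bounded_closed)
  have Diff: "f \<in> Diff1_im" "g \<in> Diff1_im" using assms(8) by (auto simp: class_A_def)
  obtain Df where Df: "\<And>x. x \<in> {0..1} \<Longrightarrow> (f has_real_derivative Df x) (at x within {0..1})"
    "\<And>x. x \<in> {0..1} \<Longrightarrow> \<bar>Df x\<bar> = vector_derivative f (at x within {0..1})"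
    using Diff1_im_abs_derivative[OF Diff(1)] A(7,9,10) by auto
  obtain Dg where Dg: "\<And>x. x \<in> {0..1} \<Longrightarrow> (g has_real_derivative Dg x) (at x within {0..1})"
    "\<And>x. x \<in> {0..1} \<Longrightarrow> \<bar>Dg x\<bar> = vector_derivative g (at x within {0..1})"
    using Diff1_im_abs_derivative[OF Diff(2)] A(8,10,11) by auto
  have "interior K = {}"
  proof (rule interior_empty_of_contracted_copies[of K f g Df lam Dg])
    show "K \<subseteq> f ` K \<union> g ` K"
      unfolding K_def by (rule closure_orbit_zero_subset_images[OF assms(8)])
    show "(f has_real_derivative Df x) (at x within K)" "(g has_real_derivative Dg x) (at x within K)"
      if "x \<in> K" for x
      using DERIV_subset[OF Df(1) K01] DERIV_subset[OF Dg(1) K01] that K01 by blast+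
    show "inj_on f K" "inj_on g K" using A(5,6) K01 inj_on_subset by blast+
    show "\<bar>Df x\<bar> \<le> lam" "\<bar>Dg x\<bar> \<le> lam" if "x \<in> K" for x
    proof -
      have "x \<in> {0..1}" "x \<in> Ineg1 \<union> I0 \<union> I1" using that KU K01 by (auto simp: U_def)
      thus "\<bar>Df x\<bar> \<le> lam" "\<bar>Dg x\<bar> \<le> lam" using Df(2) Dg(2) assms(15,16) by (metis less_imp_le)+
    qed
  qed (use \<open>compact K\<close> assms(4) in auto)
  moreover have "K \<noteq> {}" using zero_in_closure_forward_orbit[OF assms(8), of 0] by (auto simp: K_def)
  ultimately have "cantor_like K"
    using \<open>compact K\<close> minimal_set_no_isolated_points[OF assms(8)]
    by (auto simp: cantor_like_def K_def)
  thus ?thesis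
    using minimal_set_iff[OF assms(8)] cantor_like_homeomorphic[OF _ cantor_like_cantor_set]
    by (simp add: K_def)
qed

end
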